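(* Let $\mathcal{S}_4\subset\mathbb{C}^2$ be the set of parameters $(a,b)$ such that the critical point $a$ of the cubic polynomial $P_{a,b}(z)=z^3-3a^2z+b$ is periodic of exact period $4$ under iteration of $P_{a,b}$. Then the affine algebraic curve $\mathcal{S}_4$ is irreducible.
   Context: For $(a,b)\in\mathbb{C}^2$ put $P_{a,b}(z)=z^3-3a^2z+b$; its critical points are $a$ and $-a$. For $n\ge 1$, $\mathcal{S}_n=\{(a,b)\in\mathbb{C}^2 : a \text{ is periodic of exact period } n \text{ under } P_{a,b}\}$, an affine algebraic curve in $\mathbb{C}^2$ (known to be smooth, so that irreducibility is equivalent to connectedness). *)

theory Defs
  imports Complex_Main "HOL-Computational_Algebra.Computational_Algebra"
begin

definition cubic :: "complex \<Rightarrow> complex \<Rightarrow> complex \<Rightarrow> complex" where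
  "cubic a b z = z ^ 3 - 3 * a\<^sup>2 * z + b"

definition exact_period :: "('a \<Rightarrow> 'a) \<Rightarrow> 'a \<Rightarrow> nat \<Rightarrow> bool" where
  "exact_period f x n \<longleftrightarrow>
     0 < n \<and> (f ^^ n) x = x \<and> (\<forall>k. 0 < k \<and> k < n \<longrightarrow> (f ^^ k) x \<noteq> x)"

definition period_curve :: "nat \<Rightarrow> (complex \<times> complex) set" where
  "period_curve n = {(a, b). exact_period (cubic a b) a n}"

text \<open>
  A polynomial in \<open>\<complex>[a, b]\<close> is represented as an element of \<open>(\<complex>[a])[b]\<close>: the outer variable
  is the second coordinate, and its coefficients are polynomials in the first.
\<close>

definition eval2 :: "complex poly poly \<Rightarrow> complex \<times> complex \<Rightarrow> complex" where
  "eval2 p = (\<lambda>(a, b). poly (poly p [:b:]) a)"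

definition zero_locus :: "complex poly poly set \<Rightarrow> (complex \<times> complex) set" where
  "zero_locus F = {x. \<forall>p\<in>F. eval2 p x = 0}"

definition algebraic_set :: "(complex \<times> complex) set \<Rightarrow> bool" where
  "algebraic_set X \<longleftrightarrow> (\<exists>F. X = zero_locus F)"

definition affine_plane_curve :: "(complex \<times> complex) set \<Rightarrow> bool" where
  "affine_plane_curve X \<longleftrightarrow> (\<exists>p. (\<forall>c. p \<noteq> [:[:c:]:]) \<and> X = zero_locus {p})"

text \<open>
  Irreducibility in the Zariski topology; the empty set is not irreducible.
\<close>

definition irreducible_algebraic_set :: "(complex \<times> complex) set \<Rightarrow> bool" where
  "irreducible_algebraic_set X \<longleftrightarrow>
     algebraic_set X \<and> X \<noteq> {} \<and>
     (\<forall>Y Z. algebraic_set Y \<and> algebraic_set Z \<and> X = Y \<union> Z \<longrightarrow> X = Y \<or> X = Z)"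

end

theory Submission
  imports Defs "HOL-Computational_Algebra.Field_as_Ring"
begin

text \<open>
  Move the critical point to 0 and divide by the scale \<open>t = P(a) - a\<close>, which is nonzero. The cubic
  becomes \<open>g(y) = \<alpha> y\<^sup>3 + \<beta> y\<^sup>2 + 1\<close> with \<open>\<alpha> = t\<^sup>2\<close> and \<open>\<beta> = 3 a t\<close>, and the critical orbit becomes
  \<open>0, 1, s, w, \<dots>\<close>. The parameters \<open>(a, b)\<close> correspond biregularly to the pairs \<open>(s, t)\<close> with
  \<open>t \<noteq> 0\<close>, and exact period 4 becomes one equation \<open>H(s, t\<^sup>2) = 0\<close> (\<open>mem_period_curve_4\<close>). The curve
  is irreducible once \<open>H(s, t\<^sup>2)\<close> is a prime element of \<open>\<complex>[s][t]\<close>, because a polynomial vanishing on the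
  zero set of a prime polynomial is divisible by it (\<open>nullstellensatz_prime\<close>).

  The three conditions \<open>g(1) = s\<close>, \<open>g(s) = w\<close>, \<open>g(w) = 0\<close> are linear in \<open>\<alpha>\<close> and \<open>\<beta>\<close>. Eliminating these
  gives a relation between \<open>s\<close> and \<open>w\<close> alone, a monic quartic in \<open>w\<close>:
  \<open>w\<^sup>2 (w - 1)\<^sup>2 = s\<^sup>2 (s - 1) (w\<^sup>3 - s w\<^sup>2 - 1)\<close>.
  It is irreducible (\<open>irreducible_orbit_quartic\<close>): at \<open>s = 1\<close> it reduces to \<open>w\<^sup>2 (w - 1)\<^sup>2\<close>, but its values
  at \<open>w = 0\<close> and \<open>w = 1\<close> have only simple zeros there, which leaves room for two quadratic factors only;
  these are then determined up to finitely many choices, and none of them has the right coefficient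
  of \<open>w\<^sup>3\<close>. As \<open>w\<close> is linear in \<open>x = t\<^sup>2\<close> over \<open>\<complex>[s]\<close>, the polynomial \<open>H(s, x)\<close> is irreducible as well
  (\<open>irreducible_return_quartic\<close>).

  It remains to adjoin the square root \<open>t\<close> of \<open>x\<close>. If \<open>H(s, t\<^sup>2)\<close> were reducible, \<open>H\<close> would be a norm
  \<open>p\<^sup>2 - x q\<^sup>2\<close> up to a constant (\<open>irreducible_pcompose_square\<close>). As \<open>H\<close> has even degree 4 in \<open>x\<close>, its
  leading coefficient \<open>s\<^sup>5 (s - 1)\<^sup>3\<close> would then be a square up to a constant.
\<close>

section \<open>Polynomials vanishing on a plane curve\<close>

text \<open>
  This replaces passing to the fraction field of the coefficients. A nonzero element \<open>d\<close> of least
  degree in the ideal \<open>(P, h)\<close> divides every element of the ideal up to a constant, by pseudo-division.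
  If \<open>d\<close> had positive degree, primality would make \<open>P\<close> divide \<open>d\<close>, and hence \<open>h\<close>.
\<close>

lemma prime_elem_bezout_const:
  fixes P h :: "'a::idom poly"
  assumes P: "prime_elem P" "degree P > 0" and h: "\<not> P dvd h"
  obtains u v r where "r \<noteq> 0" and "u * P + v * h = [:r:]"
proof -
  define I where "I = {d. d \<noteq> 0 \<and> (\<exists>u v. d = u * P + v * h)}"
  have "P = 1 * P + 0 * h" and "P \<noteq> 0"
    using P by auto
  hence "P \<in> I"
    unfolding I_def by blast
  then obtain d where d: "d \<in> I" and least: "\<And>e. e \<in> I \<Longrightarrow> degree d \<le> degree e"
    using ex_has_least_nat[of "\<lambda>d. d \<in> I" P degree] by blast
  from d obtain u v where d0: "d \<noteq> 0" and duv: "d = u * P + v * h"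
    by (auto simp: I_def)
  have d_dvd: "\<exists>c q. c \<noteq> 0 \<and> smult c f = d * q" if "f = a * P + b * h" for f a b
  proof -
    obtain q r where qr: "pseudo_divmod f d = (q, r)"
      by (cases "pseudo_divmod f d")
    define c where "c = coeff d (degree d) ^ (Suc (degree f) - degree d)"
    have eq: "smult c f = d * q + r" and r: "r = 0 \<or> degree r < degree d"
      using pseudo_divmod[OF d0 qr] by (auto simp: c_def)
    have "r = ([:c:] * a - q * u) * P + ([:c:] * b - q * v) * h"
      using eq unfolding that duv by (simp add: algebra_simps smult_add_right)
    hence "r = 0"
      using r least[of r] by (force simp: I_def)
    moreover have "c \<noteq> 0"
      using d0 by (simp add: c_def)
    ultimately show ?thesis
      using eq by auto
  qed
  have const: "\<not> P dvd [:c:]" if "c \<noteq> 0" for c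
    using P that dvd_imp_degree_le[of P "[:c:]"] by auto
  have cancel: "P dvd f" if "c \<noteq> 0" "P dvd smult c f" for c f
  proof -
    have "P dvd [:c:] * f"
      using that by simp
    hence "P dvd [:c:] \<or> P dvd f"
      by (rule prime_elem_dvd_multD[OF P(1)])
    with const[OF that(1)] show ?thesis
      by blast
  qed
  have "degree d = 0"
  proof (rule ccontr)
    assume deg: "degree d \<noteq> 0"
    obtain c q where cq: "c \<noteq> 0" "smult c P = d * q"
      using d_dvd[of P 1 0] by auto
    have "P dvd d * q"
      by (metis cq(2) dvd_refl dvd_smult)
    hence "P dvd d \<or> P dvd q"
      using P by (simp add: prime_elem_dvd_mult_iff)
    thus False
    proof
      assume "P dvd d"
      obtain c' q' where "c' \<noteq> 0" "smult c' h = d * q'"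
        using d_dvd[of h 0 1] by auto
      with \<open>P dvd d\<close> have "P dvd h"
        using cancel[of c' h] by auto
      with h show False ..
    next
      assume "P dvd q"
      then obtain q' where "q = P * q'" ..
      with cq have "P * [:c:] = P * (d * q')"
        by (simp add: algebra_simps)
      moreover have "P \<noteq> 0"
        using P by auto
      ultimately have "[:c:] = d * q'"
        by (metis mult_cancel_left)
      moreover from this have "d * q' \<noteq> 0"
        using cq by auto
      ultimately have "degree d + degree q' = 0"
        by (metis degree_mult_eq degree_pCons_0 mult_zero_left mult_zero_right)
      with deg show False by simp
    qed
  qed
  then obtain r where "d = [:r:]"
    by (rule degree_eq_zeroE)
  with d0 have "r \<noteq> 0"
    by auto
  moreover have "u * P + v * h = [:r:]"
    using \<open>d = [:r:]\<close> duv by simp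
  ultimately show thesis
    by (rule that)
qed

lemma eval2_algebra [simp]:
  "eval2 (p + q) x = eval2 p x + eval2 q x"
  "eval2 (p - q) x = eval2 p x - eval2 q x"
  "eval2 (p * q) x = eval2 p x * eval2 q x"
  "eval2 (p ^ n) x = eval2 p x ^ n"
  "eval2 0 x = 0" "eval2 1 x = 1"
  by (auto simp: eval2_def split: prod.splits)

lemma eval2_pCons [simp]: "eval2 (pCons c p) (a, b) = poly c a + b * eval2 p (a, b)"
  by (simp add: eval2_def)

lemma eval2_smult [simp]: "eval2 (smult c p) (a, b) = poly c a * eval2 p (a, b)"
  by (simp add: eval2_def)

lemma eval2_eq_poly_map_poly: "eval2 p (a, b) = poly (map_poly (\<lambda>c. poly c a) p) b"
  by (induction p) (auto simp: map_poly_pCons)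

text \<open>
  The Nullstellensatz for one prime equation in the plane. If \<open>P\<close> did not divide \<open>h\<close>, a nonzero
  polynomial \<open>r\<close> in the first variable alone would vanish at the first coordinate of every zero of
  \<open>P\<close>; but \<open>P\<close> has zeros above all points at which its leading coefficient does not vanish.
\<close>

lemma nullstellensatz_prime:
  assumes P: "prime_elem P" "degree P > 0"
    and vanish: "\<And>a b. eval2 P (a, b) = 0 \<Longrightarrow> eval2 h (a, b) = 0"
  shows "P dvd h"
proof (rule ccontr)
  assume "\<not> P dvd h"
  then obtain u v r where r: "r \<noteq> 0" and bezout: "u * P + v * h = [:r:]"
    using prime_elem_bezout_const[OF P] by metis
  have "lead_coeff P * r \<noteq> 0"
    using P r by auto
  then obtain a where a: "poly (lead_coeff P) a \<noteq> 0" "poly r a \<noteq> 0"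
    by (metis poly_all_0_iff_0 poly_mult mult_eq_0_iff)
  have "degree (map_poly (\<lambda>c. poly c a) P) = degree P"
    using a by (intro map_poly_degree_eq) auto
  then obtain b where "poly (map_poly (\<lambda>c. poly c a) P) b = 0"
    using fundamental_theorem_of_algebra P(2) by (metis constant_degree less_irrefl)
  hence "eval2 P (a, b) = 0"
    by (simp add: eval2_eq_poly_map_poly)
  with vanish have "eval2 (u * P + v * h) (a, b) = 0"
    by simp
  with a show False
    by (simp add: bezout)
qed

section \<open>Substituting a square into an irreducible polynomial\<close>

lemma even_odd_parts:
  fixes f :: "'a::comm_ring_1 poly"
  obtains p q where "f = pcompose p [:0, 0, 1:] + [:0, 1:] * pcompose q [:0, 0, 1:]"
proof -
  have "\<exists>p q. f = pcompose p [:0, 0, 1:] + [:0, 1:] * pcompose q [:0, 0, 1:]"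
  proof (induction f)
    case 0
    show ?case by (intro exI[of _ 0]) simp
  next
    case (pCons c f)
    then obtain p q where f: "f = pcompose p [:0, 0, 1:] + [:0, 1:] * pcompose q [:0, 0, 1:]"
      by blast
    have "pCons c f = [:c:] + [:0, 1:] * f"
      by simp
    also have "\<dots> = pcompose ([:c:] + [:0, 1:] * q) [:0, 0, 1:] + [:0, 1:] * pcompose p [:0, 0, 1:]"
      unfolding f by (simp add: pcompose_add pcompose_mult pcompose_pCons algebra_simps)
    finally show ?case by blast
  qed
  with that show thesis by blast
qed

text \<open>
  The leading terms of \<open>p\<^sup>2\<close> and of \<open>x q\<^sup>2\<close> cannot cancel, since their degrees have different parity.
\<close>

lemma lead_coeff_even_norm:
  fixes p q :: "'a::idom poly"
  assumes even: "even (degree (p\<^sup>2 - [:0, 1:] * q\<^sup>2))"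
  shows "lead_coeff (p\<^sup>2 - [:0, 1:] * q\<^sup>2) = (lead_coeff p)\<^sup>2"
proof (cases "q = 0")
  case True
  thus ?thesis by (simp add: lead_coeff_power)
next
  case False
  define r where "r = [:0, 1:] * q\<^sup>2"
  have dr: "degree r = 2 * degree q + 1"
    unfolding r_def using False by (simp add: degree_mult_eq degree_power_eq)
  have dp: "degree (p\<^sup>2) = 2 * degree p"
    by (cases "p = 0") (simp_all add: degree_power_eq)
  have "\<not> degree (p\<^sup>2) < degree r"
  proof
    assume "degree (p\<^sup>2) < degree r"
    hence "degree (p\<^sup>2 - r) = degree r"
      using degree_add_eq_right[of "p\<^sup>2" "- r"] by simp
    with even dr show False by (simp add: r_def)
  qed
  moreover have "degree (p\<^sup>2) \<noteq> degree r"
    unfolding dr dp by presburger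
  ultimately have less: "degree r < degree (p\<^sup>2)"
    by linarith
  hence "degree (p\<^sup>2 - r) = degree (p\<^sup>2)"
    using degree_add_eq_left[of "- r" "p\<^sup>2"] by simp
  with less have "lead_coeff (p\<^sup>2 - r) = lead_coeff (p\<^sup>2)"
    by (simp add: coeff_eq_0)
  thus ?thesis by (simp add: lead_coeff_power r_def)
qed

text \<open>
  This says that \<open>x\<close> has no square root in the function field of \<open>H(x) = 0\<close>. For a factor
  \<open>f(t) = p(t\<^sup>2) + t q(t\<^sup>2)\<close> of \<open>H(t\<^sup>2)\<close> the norm \<open>f(t) f(-t)\<close> is \<open>p\<^sup>2 - x q\<^sup>2\<close> at \<open>x = t\<^sup>2\<close>, and \<open>p\<^sup>2 - x q\<^sup>2\<close> divides \<open>H\<^sup>2\<close>. The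
  norm of one of two factors is divisible by \<open>H\<close>; then either the norm of the other factor is a unit,
  or \<open>H\<close> itself is a norm up to a unit. The latter would make its leading coefficient a square up to a unit.
\<close>

lemma irreducible_pcompose_square:
  fixes H :: "'a::idom_divide poly"
  assumes prime: "prime_elem H" and even: "even (degree H)"
    and nonsquare: "\<And>u r. u dvd 1 \<Longrightarrow> u * lead_coeff H \<noteq> r\<^sup>2"
  shows "irreducible (pcompose H [:0, 0, 1:])"
proof -
  let ?sq = "\<lambda>p. pcompose p [:0, 0, 1:] :: 'a poly"
  let ?join = "\<lambda>p q. ?sq p + [:0, 1:] * ?sq q"
  let ?N = "\<lambda>p q. p\<^sup>2 - [:0, 1:] * q\<^sup>2 :: 'a poly"
  have inj: "p = q" if "?sq p = ?sq q" for p q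
    using pcompose_eq_0[of "p - q" "[:0, 0, 1:]"] that by (simp add: pcompose_diff)
  have H0: "H \<noteq> 0" "\<not> H dvd 1"
    using prime by (auto simp: prime_elem_def)
  have refl_sq: "pcompose (?sq r) [:0, -1:] = ?sq r" for r
    by (simp add: pcompose_assoc[symmetric] pcompose_pCons)
  have norm: "?sq (?N r s) = ?join r s * pcompose (?join r s) [:0, -1:]" for r s
  proof -
    have "pcompose (?join r s) [:0, -1:] = ?sq r - [:0, 1:] * ?sq s"
      by (simp only: pcompose_add pcompose_mult refl_sq) (simp add: pcompose_pCons)
    moreover have "?sq [:0, 1:] = [:0, 1:]\<^sup>2"
      by (simp add: pcompose_pCons power2_eq_square)
    ultimately show ?thesis
      by (simp only: pcompose_diff pcompose_mult power2_eq_square) (simp only: algebra_simps)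
  qed
  have norm_mult: "?N p q * ?N p' q' = H * H"
    if fg: "?sq H = ?join p q * ?join p' q'" for p q p' q'
  proof (rule inj)
    have "?sq (?N p q * ?N p' q')
        = (?join p q * ?join p' q') * pcompose (?join p q * ?join p' q') [:0, -1:]"
      unfolding pcompose_mult[of _ _ "[:0, 0, 1:]"] norm pcompose_mult[of _ _ "[:0, -1:]"]
      by (simp only: mult_ac)
    also have "\<dots> = ?sq (H * H)"
      by (simp only: fg[symmetric] refl_sq pcompose_mult)
    finally show "?sq (?N p q * ?N p' q') = ?sq (H * H)" .
  qed
  have unit: "?join p' q' dvd 1"
    if fg: "?sq H = ?join p q * ?join p' q'" and dvd: "H dvd ?N p q" for p q p' q'
  proof -
    from dvd obtain c where c: "?N p q = H * c" ..
    with norm_mult[OF fg] have "H * (c * ?N p' q') = H * H"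
      by (simp only: mult.assoc)
    with H0 have H: "H = c * ?N p' q'"
      by (simp only: mult_cancel_left) simp
    have "\<not> c dvd 1"
    proof
      assume "c dvd 1"
      then obtain c0 where c0: "c = [:c0:]" "c0 dvd 1"
        by (rule is_unit_polyE)
      hence c0': "c0 \<noteq> 0" by auto
      have N: "?N p q = smult c0 H"
        unfolding c c0 by (simp add: mult.commute)
      with even c0' have "lead_coeff (?N p q) = (lead_coeff p)\<^sup>2"
        by (intro lead_coeff_even_norm) simp
      with N have "c0 * lead_coeff H = (lead_coeff p)\<^sup>2"
        using c0' by simp
      with nonsquare[OF c0(2)] show False by blast
    qed
    with irreducibleD[OF prime_elem_imp_irreducible[OF prime] H] have "?N p' q' dvd 1"
      by blast
    then obtain d where "?N p' q' = [:d:]" "d dvd 1"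
      by (rule is_unit_polyE)
    hence "?sq (?N p' q') dvd 1"
      by (simp add: is_unit_const_poly_iff)
    thus ?thesis
      unfolding norm by (rule dvd_mult_left)
  qed
  show ?thesis
  proof (rule irreducibleI)
    show "?sq H \<noteq> 0"
      using H0 pcompose_eq_0[of H "[:0, 0, 1:]"] by auto
    show "\<not> ?sq H dvd 1"
    proof
      assume "?sq H dvd 1"
      then obtain c where c: "?sq H = [:c:]" "c dvd 1"
        by (rule is_unit_polyE)
      hence "H = [:c:]"
        using inj[of H "[:c:]"] by simp
      with c H0(2) show False
        by (metis is_unit_const_poly_iff)
    qed
    fix f g assume fg: "?sq H = f * g"
    obtain p q where f: "f = ?join p q" by (rule even_odd_parts)
    obtain p' q' where g: "g = ?join p' q'" by (rule even_odd_parts)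
    have "H dvd ?N p q * ?N p' q'"
      unfolding norm_mult[OF fg[unfolded f g]] by simp
    hence "H dvd ?N p q \<or> H dvd ?N p' q'"
      by (rule prime_elem_dvd_multD[OF prime])
    thus "f dvd 1 \<or> g dvd 1"
    proof
      assume "H dvd ?N p q"
      hence "?join p' q' dvd 1"
        by (rule unit[OF fg[unfolded f g]])
      thus ?thesis
        unfolding g ..
    next
      assume "H dvd ?N p' q'"
      moreover have "?sq H = ?join p' q' * ?join p q"
        using fg unfolding f g by (simp only: mult.commute)
      ultimately have "?join p q dvd 1"
        by (intro unit)
      thus ?thesis
        unfolding f ..
    qed
  qed
qed

section \<open>The quartic relation between the last two orbit ratios\<close>

text \<open>
  The coefficient \<open>k = s\<^sup>2 (s - 1)\<close> of the squared scale in the third orbit ratio \<open>w\<close>, see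
  \<open>third_ratio\<close> below.
\<close>

definition ratio_slope :: "complex poly" where
  "ratio_slope = [:0, 0, -1, 1:]"

text \<open>
  If \<open>g(y) = \<alpha> y\<^sup>3 + \<beta> y\<^sup>2 + 1\<close> moves the critical point 0 along \<open>0, 1, s, w, 0\<close>, then
  \<open>\<alpha> + \<beta> = s - 1\<close>, \<open>\<alpha> s + \<beta> = (w - 1) / s\<^sup>2\<close> and \<open>\<alpha> w + \<beta> = - 1 / w\<^sup>2\<close>. Eliminating \<open>\<alpha>\<close> and \<open>\<beta>\<close>
  leaves \<open>w\<^sup>2 (w - 1)\<^sup>2 = k (w\<^sup>3 - s w\<^sup>2 - 1)\<close>. The outer variable is \<open>w\<close>, the inner one \<open>s\<close>.
\<close>

definition orbit_quartic :: "complex poly poly" where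
  "orbit_quartic =
     [:0, 1:]\<^sup>2 * [:-1, 1:]\<^sup>2 - [:ratio_slope:] * ([:0, 1:] ^ 3 - [:[:0, 1:]:] * [:0, 1:]\<^sup>2 - 1)"

lemma orbit_quartic_coeffs:
  "orbit_quartic = [:ratio_slope, 0, 1 + ratio_slope * [:0, 1:], - 2 - ratio_slope, 1:]"
proof -
  have two: "(2 :: complex poly) = [:2:]"
    by (metis numeral_poly)
  show ?thesis
    by (simp add: orbit_quartic_def power2_eq_square power3_eq_cube two one_pCons)
qed

lemma poly_orbit_quartic:
  "poly orbit_quartic w
     = w\<^sup>2 * (w - 1)\<^sup>2 - ratio_slope * (w ^ 3 - [:0, 1:] * w\<^sup>2 - 1)"
  by (simp add: orbit_quartic_def one_pCons) (simp add: power2_eq_square power3_eq_cube algebra_simps one_pCons)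

lemma ratio_slope_factored: "ratio_slope = [:0, 1:]\<^sup>2 * [:-1, 1:]"
  by (simp add: ratio_slope_def power2_eq_square)

lemma degree_orbit_quartic: "degree orbit_quartic = 4" "lead_coeff orbit_quartic = 1"
  by (simp_all add: orbit_quartic_coeffs numeral_poly)

lemma divisor_of_X_power:
  fixes u :: "complex poly"
  assumes "q * u = [:0, 1:] ^ n" and "poly u 1 = 1"
  shows "\<exists>i\<le>n. u = [:0, 1:] ^ i"
  using assms
proof (induction n arbitrary: q u)
  case 0
  hence "u dvd 1"
    by (metis dvd_triv_right power_0)
  then obtain c where "u = [:c:]"
    by (auto simp: is_unit_poly_iff)
  with 0 show ?case
    by (simp add: one_pCons)
next
  case (Suc n)
  have "poly q 0 * poly u 0 = 0"
    using arg_cong[OF Suc.prems(1), of "\<lambda>p. poly p 0"] by simp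
  hence "[:0, 1:] dvd q \<or> [:0, 1:] dvd u"
    by (simp add: dvd_iff_poly_eq_0)
  thus ?case
  proof
    assume "[:0, 1:] dvd q"
    then obtain q' where "q = [:0, 1:] * q'" ..
    with Suc.prems have "[:0, 1:] * (q' * u) = [:0, 1:] * [:0, 1:] ^ n"
      by (simp only: power_Suc mult_ac)
    hence "q' * u = [:0, 1:] ^ n"
      by (metis mult_cancel_left pCons_eq_0_iff zero_neq_one)
    from Suc.IH[OF this Suc.prems(2)] show ?thesis
      using le_SucI by blast
  next
    assume "[:0, 1:] dvd u"
    then obtain u' where u': "u = [:0, 1:] * u'" ..
    with Suc.prems have "[:0, 1:] * (q * u') = [:0, 1:] * [:0, 1:] ^ n"
      by (simp only: power_Suc mult_ac)
    hence "q * u' = [:0, 1:] ^ n"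
      by (metis mult_cancel_left pCons_eq_0_iff zero_neq_one)
    moreover have "poly u' 1 = 1"
      using Suc.prems u' by simp
    ultimately obtain i where "i \<le> n" "u' = [:0, 1:] ^ i"
      using Suc.IH by blast
    thus ?thesis
      by (intro exI[of _ "Suc i"]) (simp add: u')
  qed
qed

text \<open>
  A divisor of \<open>s\<^sup>n (s - 1)\<close> that takes the value 1 at 1 is a power of \<open>s\<close>. The point 2 serves to
  compare such divisors because \<open>s - 1\<close> equals 1 there.
\<close>

lemma divisor_pair_value_at_2:
  fixes q u :: "complex poly"
  assumes "q * u = [:0, 1:] ^ n * [:-1, 1:]" and "poly u 1 = 1"
  obtains i where "i \<le> n" "poly u 2 = 2 ^ i" "poly q 2 = 2 ^ (n - i)"
proof -
  have "poly q 1 * poly u 1 = 0"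
    using arg_cong[OF assms(1), of "\<lambda>p. poly p 1"] by simp
  with assms(2) have "[:-1, 1:] dvd q"
    by (simp add: dvd_iff_poly_eq_0)
  then obtain q' where q': "q = [:-1, 1:] * q'" ..
  with assms(1) have "[:-1, 1:] * (q' * u) = [:-1, 1:] * [:0, 1:] ^ n"
    by (simp only: mult_ac)
  hence eq: "q' * u = [:0, 1:] ^ n"
    by (metis mult_cancel_left pCons_eq_0_iff zero_neq_one)
  with assms(2) obtain i where i: "i \<le> n" "u = [:0, 1:] ^ i"
    using divisor_of_X_power by blast
  have "[:0, 1:] ^ i * q' = [:0, 1:] ^ i * [:0, 1:] ^ (n - i)"
    using eq i by (simp add: mult.commute flip: power_add)
  moreover have "[:0, 1:] ^ i \<noteq> (0 :: complex poly)"
    by simp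
  ultimately have "q' = [:0, 1:] ^ (n - i)"
    by (metis mult_cancel_left)
  with i q' show thesis
    by (intro that[of i]) simp_all
qed

text \<open>
  A root \<open>w(s)\<close> satisfies \<open>(w (w - 1))\<^sup>2 = s\<^sup>2 (s - 1) (w\<^sup>3 - s w\<^sup>2 - 1)\<close>. At \<open>s = 1\<close> the left side vanishes
  to even order, and the right side exactly once, since its last factor is -1 for \<open>w = 0\<close> and \<open>w = 1\<close>.
\<close>

lemma orbit_quartic_no_root: "poly orbit_quartic w \<noteq> 0"
proof
  assume "poly orbit_quartic w = 0"
  hence eq: "(w * (w - 1))\<^sup>2 = [:0, 1:]\<^sup>2 * [:-1, 1:] * (w ^ 3 - [:0, 1:] * w\<^sup>2 - 1)"
    by (simp add: poly_orbit_quartic ratio_slope_factored power_mult_distrib)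
  from arg_cong[OF this, of "\<lambda>p. poly p 1"] have w1: "poly w 1 = 0 \<or> poly w 1 = 1"
    by simp
  hence "[:-1, 1:] dvd w * (w - 1)"
    by (auto simp: dvd_iff_poly_eq_0)
  then obtain e where "w * (w - 1) = [:-1, 1:] * e" ..
  with eq have "[:-1, 1:] * ([:-1, 1:] * e\<^sup>2)
      = [:-1, 1:] * ([:0, 1:]\<^sup>2 * (w ^ 3 - [:0, 1:] * w\<^sup>2 - 1))"
    by (simp only: power2_eq_square mult_ac)
  hence "[:-1, 1:] * e\<^sup>2 = [:0, 1:]\<^sup>2 * (w ^ 3 - [:0, 1:] * w\<^sup>2 - 1)"
    by (metis mult_cancel_left pCons_eq_0_iff zero_neq_one)
  from arg_cong[OF this, of "\<lambda>p. poly p 1"] w1 show False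
    by auto
qed

text \<open>
  At \<open>s = 1\<close> the quartic becomes \<open>w\<^sup>2 (w - 1)\<^sup>2\<close>, while its values \<open>s\<^sup>2 (s - 1)\<close> at \<open>w = 0\<close> and
  \<open>s\<^sup>3 (s - 1)\<close> at \<open>w = 1\<close> have only simple zeros there. So the two factors reduce to \<open>w\<^sup>2\<close> and
  \<open>(w - 1)\<^sup>2\<close>, and the values of both factors at \<open>w = 0\<close> and \<open>w = 1\<close> are known up to the exponents
  of \<open>s\<close>. No choice of exponents fits the coefficient of \<open>w\<^sup>3\<close>.
\<close>

lemma orbit_quartic_no_quadratic_factors:
  assumes prod: "[:q, p, 1:] * [:u, r, 1:] = orbit_quartic" and q1: "poly q 1 = 0"
  shows False
proof -
  have eqs: "q * u = ratio_slope" "q * r + p * u = 0"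
    "q + (p * r + u) = 1 + ratio_slope * [:0, 1:]" "p + r = - 2 - ratio_slope"
    using prod unfolding orbit_quartic_coeffs by (simp_all add: algebra_simps)
  have "poly u 1 \<noteq> 0"
  proof
    assume "poly u 1 = 0"
    with q1 have "[:-1, 1:] dvd q" "[:-1, 1:] dvd u"
      by (simp_all add: dvd_iff_poly_eq_0)
    then obtain q' u' where "q = [:-1, 1:] * q'" "u = [:-1, 1:] * u'"
      by (auto elim!: dvdE)
    with eqs(1) have "[:-1, 1:] * ([:-1, 1:] * (q' * u')) = [:-1, 1:] * [:0, 1:]\<^sup>2"
      by (simp only: ratio_slope_factored mult_ac)
    hence "[:-1, 1:] * (q' * u') = [:0, 1:]\<^sup>2"
      by (metis mult_cancel_left pCons_eq_0_iff zero_neq_one)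
    from arg_cong[OF this, of "\<lambda>p. poly p 1"] show False
      by simp
  qed
  moreover have "poly ratio_slope 1 = 0"
    by (simp add: ratio_slope_def)
  ultimately have at1: "poly p 1 = 0" "poly r 1 = -2" "poly u 1 = 1"
    using arg_cong[OF eqs(2), of "\<lambda>p. poly p 1"] arg_cong[OF eqs(3), of "\<lambda>p. poly p 1"]
      arg_cong[OF eqs(4), of "\<lambda>p. poly p 1"] q1 by auto
  have "q * u = [:0, 1:] ^ 2 * [:-1, 1:]"
    using eqs(1) by (simp add: ratio_slope_factored)
  then obtain i where i: "i \<le> 2" "poly u 2 = 2 ^ i" "poly q 2 = 2 ^ (2 - i)"
    using at1(3) by (rule divisor_pair_value_at_2)
  \<comment> \<open>The values of the two factors at \<open>w = 1\<close> multiply to the value of the quartic.\<close>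
  have "(1 + r + u) * (1 + p + q) = 1 + (p + r) + (q + (p * r + u)) + (q * r + p * u) + q * u"
    by (simp add: algebra_simps)
  also have "\<dots> = [:0, 1:] ^ 3 * [:-1, 1:]"
    unfolding eqs by (simp add: ratio_slope_factored power2_eq_square power3_eq_cube)
  finally have "(1 + r + u) * (1 + p + q) = [:0, 1:] ^ 3 * [:-1, 1:]" .
  then obtain j where j: "j \<le> 3" "poly (1 + p + q) 2 = 2 ^ j" "poly (1 + r + u) 2 = 2 ^ (3 - j)"
    using at1 q1 by (elim divisor_pair_value_at_2) auto
  \<comment> \<open>At \<open>s = 2\<close> only powers of 2 remain: the left side of the final equation is 6 or 9, the right
    side is 0 or 1.\<close>
  have "poly p 2 + poly r 2 = -6"
    using arg_cong[OF eqs(4), of "\<lambda>p. poly p 2"] by (simp add: ratio_slope_def)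
  moreover have "poly (1 + p + q) 2 + poly (1 + r + u) 2
      = 2 + (poly p 2 + poly r 2) + (poly u 2 + poly q 2)"
    by simp
  ultimately have "2 ^ j + 2 ^ (3 - j) = -4 + (2 ^ i + (2 ^ (2 - i) :: complex))"
    unfolding i j by simp
  moreover have "i = 0 \<or> i = 1 \<or> i = 2" "j = 0 \<or> j = 1 \<or> j = 2 \<or> j = 3"
    using i j by linarith+
  ultimately show False
    by auto
qed

lemma irreducible_orbit_quartic: "irreducible orbit_quartic"
proof -
  have unit: "is_unit f" if fg: "orbit_quartic = f * g" and le: "degree f \<le> degree g" for f g
  proof -
    have nz: "f \<noteq> 0" "g \<noteq> 0"
      using fg degree_orbit_quartic by auto
    hence deg: "degree f + degree g = 4"
      using fg degree_orbit_quartic by (metis degree_mult_eq)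
    have lead: "lead_coeff f * lead_coeff g = 1"
      using fg degree_orbit_quartic by (metis lead_coeff_mult)
    consider "degree f = 0" | "degree f = 1" | "degree f = 2" "degree g = 2"
      using deg le by linarith
    thus ?thesis
    proof cases
      case 1
      then obtain c where "f = [:c:]" by (rule degree_eq_zeroE)
      moreover from this lead have "c * lead_coeff g = 1"
        by simp
      hence "is_unit c"
        by (metis dvd_triv_left)
      ultimately show ?thesis
        by (simp add: is_unit_const_poly_iff)
    next
      case 2
      have f: "f = [:coeff f 0, lead_coeff f:]"
        using 2 by (intro poly_eqI) (simp add: coeff_pCons coeff_eq_0 split: nat.split)
      have "poly f (- coeff f 0 * lead_coeff g) = coeff f 0 * (1 - lead_coeff f * lead_coeff g)"
        by (subst f) (simp add: algebra_simps)
      with lead have "poly orbit_quartic (- coeff f 0 * lead_coeff g) = 0"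
        by (simp add: fg)
      with orbit_quartic_no_root show ?thesis by blast
    next
      case 3
      have monic_quadratic: "\<exists>q p. h = [:q, p, 1:]"
        if "degree h = 2" "lead_coeff h = 1" for h :: "complex poly poly"
      proof -
        have "h = [:coeff h 0, coeff h 1, coeff h 2:]"
          using that(1) by (intro poly_eqI) (simp add: coeff_pCons coeff_eq_0 numeral_2_eq_2 split: nat.split)
        with that show ?thesis
          by (intro exI) simp
      qed
      have lead': "lead_coeff f \<noteq> 0" "lead_coeff g \<noteq> 0" "lead_coeff g * lead_coeff f = 1"
        using lead nz by (simp_all add: mult.commute)
      have "degree (smult (lead_coeff g) f) = 2" "lead_coeff (smult (lead_coeff g) f) = 1"
        "degree (smult (lead_coeff f) g) = 2" "lead_coeff (smult (lead_coeff f) g) = 1"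
        unfolding lead_coeff_smult using 3 lead lead' by simp_all
      then obtain q p u r where qp: "smult (lead_coeff g) f = [:q, p, 1:]"
        and ur: "smult (lead_coeff f) g = [:u, r, 1:]"
        using monic_quadratic[of "smult (lead_coeff g) f"] monic_quadratic[of "smult (lead_coeff f) g"]
        by blast
      have prod: "[:q, p, 1:] * [:u, r, 1:] = orbit_quartic"
        using lead by (simp add: fg mult.commute flip: qp ur)
      have "q * u = ratio_slope"
        using prod unfolding orbit_quartic_coeffs by (simp add: mult.commute)
      from arg_cong[OF this, of "\<lambda>p. poly p 1"] have "poly q 1 = 0 \<or> poly u 1 = 0"
        by (simp add: ratio_slope_def)
      moreover have "[:u, r, 1:] * [:q, p, 1:] = orbit_quartic"
        using prod by (simp only: mult.commute)
      ultimately show ?thesis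
        using orbit_quartic_no_quadratic_factors prod by blast
    qed
  qed
  show ?thesis
  proof (rule irreducibleI)
    have "degree orbit_quartic \<noteq> 0"
      using degree_orbit_quartic by simp
    thus "orbit_quartic \<noteq> 0" by auto
    show "\<not> is_unit orbit_quartic"
    proof
      assume "is_unit orbit_quartic"
      then obtain c where "orbit_quartic = [:c:]"
        by (rule is_unit_polyE)
      from arg_cong[OF this, of degree] have "degree orbit_quartic = 0"
        by simp
      with \<open>degree orbit_quartic \<noteq> 0\<close> show False ..
    qed
    show "is_unit f \<or> is_unit g" if "orbit_quartic = f * g" for f g
    proof (cases "degree f \<le> degree g")
      case True
      with that unit show ?thesis by blast
    next
      case False
      moreover have "orbit_quartic = g * f"
        using that by (simp only: mult.commute)
      ultimately show ?thesis
        using unit[of g f] by simp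
    qed
  qed
qed

section \<open>The return polynomial in the first ratio and the squared scale\<close>

text \<open>
  The polynomial \<open>F(w) = k\<^sup>n f((w - e) / k)\<close> with \<open>n = degree f\<close>, described without division.
\<close>

lemma linear_substitution_homogenized:
  fixes f :: "'a::idom poly"
  assumes "k \<noteq> 0"
  obtains F where "pcompose F [:e, k:] = smult (k ^ degree f) f" and "degree F = degree f"
proof -
  have "\<exists>F. pcompose F [:e, k:] = smult (k ^ degree f) f"
  proof (induction f)
    case 0
    show ?case by (intro exI[of _ 0]) simp
  next
    case (pCons c f)
    then obtain F where F: "pcompose F [:e, k:] = smult (k ^ degree f) f"
      by blast
    show ?case
    proof (cases "f = 0")
      case True
      thus ?thesis by (intro exI[of _ "[:c:]"]) simp
    next
      case False
      have "pcompose ([:c * k ^ Suc (degree f):] + [:-e, 1:] * F) [:e, k:]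
          = [:c * k ^ Suc (degree f):] + pcompose [:-e, 1:] [:e, k:] * smult (k ^ degree f) f"
        by (simp only: pcompose_add pcompose_mult F pcompose_const)
      also have "\<dots> = smult (k ^ degree (pCons c f)) (pCons c f)"
        using False by (simp add: pcompose_pCons mult.commute)
      finally show ?thesis by blast
    qed
  qed
  then obtain F where F: "pcompose F [:e, k:] = smult (k ^ degree f) f" ..
  moreover have "degree F = degree f"
    using arg_cong[OF F, of degree] assms by (simp add: degree_pcompose)
  ultimately show thesis by (rule that)
qed

text \<open>
  With \<open>x = t\<^sup>2\<close> for the scale \<open>t\<close> of the orbit, the third ratio is \<open>w = 1 + k (1 + x)\<close>. Here and
  below the outer variable is \<open>x\<close>, the inner one \<open>s\<close>.
\<close>

definition third_ratio :: "complex poly poly" where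
  "third_ratio = [:1 + ratio_slope, ratio_slope:]"

text \<open>
  The fourth iterate returns to the critical point when \<open>w\<^sup>2 (x (w - 1) + s - 1) + 1\<close> vanishes. This
  expression is divisible by \<open>s\<close>, as \<open>s = 0\<close> means period 2. The quotient is written in the form
  \<open>1 + s (s - 1) (\<dots>)\<close>, which shows that it is 1 for \<open>s = 0\<close> and for \<open>s = 1\<close>.
\<close>

definition return_quartic :: "complex poly poly" where
  "return_quartic = 1 + [:[:0, 1:] * [:-1, 1:]:] * [:1, 1:] *
     ([:[:-1, 1:]:] * (third_ratio + 1) + [:0, 1:] * third_ratio\<^sup>2)"

lemma eval2_third_ratio:
  "eval2 third_ratio (s, x) = 1 + s\<^sup>2 * (s - 1) * (1 + x)"
  by (simp add: third_ratio_def ratio_slope_def algebra_simps power2_eq_square)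

lemma eval2_return_quartic:
  "eval2 return_quartic (s, x) = 1 + s * (s - 1) * (x + 1) *
     ((s - 1) * (eval2 third_ratio (s, x) + 1) + x * (eval2 third_ratio (s, x))\<^sup>2)"
  by (simp add: return_quartic_def algebra_simps)

lemma return_quartic_expansion:
  "degree return_quartic = 4" "lead_coeff return_quartic = [:0, 1:] ^ 5 * [:-1, 1:] ^ 3"
proof -
  let ?k = ratio_slope and ?c = "[:0, 1:] * [:-1, 1:] :: complex poly"
  have "third_ratio\<^sup>2 = [:(1 + ?k)\<^sup>2, 2 * ((1 + ?k) * ?k), ?k\<^sup>2:]"
    by (simp add: third_ratio_def power2_eq_square)
  hence "return_quartic = [:1, 0, 0, 0, 0:] + [:?c, ?c:] * (
      [:[:-1, 1:] * (2 + ?k), [:-1, 1:] * ?k:] + pCons 0 [:(1 + ?k)\<^sup>2, 2 * ((1 + ?k) * ?k), ?k\<^sup>2:])"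
    unfolding return_quartic_def by (simp add: third_ratio_def one_pCons)
  hence "\<exists>a b c d. return_quartic = [:a, b, c, d, ?c * ?k\<^sup>2:]"
    by simp blast
  then obtain a b c d where eq: "return_quartic = [:a, b, c, d, ?c * ?k\<^sup>2:]"
    by blast
  moreover have "?c * ?k\<^sup>2 = [:0, 1:] ^ 5 * [:-1, 1:] ^ 3"
    unfolding ratio_slope_factored by (simp add: eval_nat_numeral)
  moreover have "[:0, 1:] ^ 5 * [:-1, 1:] ^ 3 \<noteq> (0 :: complex poly)"
    by simp
  ultimately show "degree return_quartic = 4" "lead_coeff return_quartic = [:0, 1:] ^ 5 * [:-1, 1:] ^ 3"
    unfolding eq by simp_all
qed

lemma orbit_quartic_third_ratio:
  "pcompose orbit_quartic third_ratio = smult ([:0, 1:] ^ 3 * [:-1, 1:]) return_quartic"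
proof -
  let ?s = "[:[:0, 1:]:] :: complex poly poly" and ?x = "[:0, 1:] :: complex poly poly"
  have X: "pcompose [:0, 1:] third_ratio = third_ratio" "pcompose [:-1, 1:] third_ratio = third_ratio - 1"
    by (simp_all add: pcompose_pCons third_ratio_def one_pCons)
  have k: "[:ratio_slope:] = ?s\<^sup>2 * (?s - 1)"
    by (simp add: ratio_slope_def one_pCons power2_eq_square)
  have r: "third_ratio = 1 + ?s\<^sup>2 * (?s - 1) * (1 + ?x)"
    unfolding k[symmetric] by (simp add: third_ratio_def one_pCons)
  have ret: "return_quartic = 1 + ?s * (?s - 1) * (?x + 1) *
     ((?s - 1) * (third_ratio + 1) + ?x * third_ratio\<^sup>2)"
    by (simp add: return_quartic_def one_pCons)
  have "pcompose orbit_quartic third_ratio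
      = third_ratio\<^sup>2 * (third_ratio - 1)\<^sup>2
        - [:ratio_slope:] * (third_ratio ^ 3 - ?s * third_ratio\<^sup>2 - 1)"
    unfolding orbit_quartic_def power2_eq_square power3_eq_cube
    by (simp only: pcompose_diff pcompose_mult pcompose_const pcompose_1 X)
  also have "\<dots> = ?s ^ 3 * (?s - 1) * return_quartic"
    unfolding ret k r by algebra
  also have "?s ^ 3 * (?s - 1) = [:[:0, 1:] ^ 3 * [:-1, 1:]:]"
    by (simp add: one_pCons power3_eq_cube)
  finally show ?thesis by simp
qed

text \<open>
  A zero of such a factor is a zero of the leading coefficient, hence 0 or 1; but there the polynomial is 1.
\<close>

lemma return_quartic_constant_factor:
  assumes "[:c:] dvd return_quartic"
  shows "is_unit c"
proof -
  obtain g where g: "return_quartic = [:c:] * g"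
    using assms ..
  have "poly c s \<noteq> 0" for s
  proof
    assume cs: "poly c s = 0"
    have "[:0, 1:] ^ 5 * [:-1, 1:] ^ 3 = lead_coeff ([:c:] * g)"
      unfolding g[symmetric] return_quartic_expansion(2) ..
    also have "\<dots> = c * lead_coeff g"
      by (simp only: lead_coeff_mult) simp
    finally have "poly ([:0, 1:] ^ 5 * [:-1, 1:] ^ 3) s = poly (c * lead_coeff g) s"
      by (rule arg_cong)
    with cs have "s = 0 \<or> s = 1"
      by simp
    hence "eval2 return_quartic (s, 0) = 1"
      by (auto simp: eval2_return_quartic)
    moreover have "eval2 return_quartic (s, 0) = 0"
      unfolding g by (simp add: cs)
    ultimately show False by simp
  qed
  hence "degree c = 0"
    using fundamental_theorem_of_algebra[of c] by (auto simp: constant_degree)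
  then obtain d where "c = [:d:]"
    by (rule degree_eq_zeroE)
  with \<open>poly c 0 \<noteq> 0\<close> show ?thesis
    by (simp add: is_unit_const_poly_iff dvd_field_iff)
qed

text \<open>
  The substitution \<open>w = 1 + k (1 + x)\<close> is linear in \<open>x\<close> and turns the orbit quartic into the return
  quartic, up to a factor from \<open>\<complex>[s]\<close>. Homogenizing a factorization back to the variable \<open>w\<close>, the prime
  orbit quartic divides one factor, which therefore has full degree.
\<close>

lemma irreducible_return_quartic: "irreducible return_quartic"
proof -
  note prime = irreducible_imp_prime_elem[OF irreducible_orbit_quartic]
  let ?c = "[:0, 1:] ^ 3 * [:-1, 1:] :: complex poly"
  have k0: "ratio_slope \<noteq> 0"
    by (simp add: ratio_slope_def)
  have R0: "return_quartic \<noteq> 0"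
    using return_quartic_expansion by auto
  show ?thesis
  proof (rule irreducibleI)
    show "return_quartic \<noteq> 0" by (rule R0)
    show "\<not> is_unit return_quartic"
    proof
      assume "is_unit return_quartic"
      then obtain c where "return_quartic = [:c:]"
        by (rule is_unit_polyE)
      from arg_cong[OF this, of degree] have "degree return_quartic = 0"
        by simp
      with return_quartic_expansion(1) show False
        by simp
    qed
    fix f g assume fg: "return_quartic = f * g"
    hence nz: "f \<noteq> 0" "g \<noteq> 0" using R0 by auto
    have deg: "degree f + degree g = 4"
      using fg nz return_quartic_expansion(1) by (metis degree_mult_eq)
    obtain F where F: "pcompose F third_ratio = smult (ratio_slope ^ degree f) f" "degree F = degree f"
      unfolding third_ratio_def by (rule linear_substitution_homogenized[OF k0])
    obtain G where G: "pcompose G third_ratio = smult (ratio_slope ^ degree g) g" "degree G = degree g"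
      unfolding third_ratio_def by (rule linear_substitution_homogenized[OF k0])
    have "pcompose (smult ?c (F * G)) third_ratio = smult (ratio_slope ^ 4 * ?c) return_quartic"
      by (simp add: pcompose_smult pcompose_mult F G fg power_add mult.commute flip: deg)
    also have "\<dots> = pcompose (smult (ratio_slope ^ 4) orbit_quartic) third_ratio"
      by (simp add: pcompose_smult orbit_quartic_third_ratio)
    finally have "pcompose (smult ?c (F * G) - smult (ratio_slope ^ 4) orbit_quartic) third_ratio = 0"
      by (simp add: pcompose_diff)
    hence "smult ?c (F * G) - smult (ratio_slope ^ 4) orbit_quartic = 0"
      by (rule pcompose_eq_0) (simp add: third_ratio_def k0)
    hence "orbit_quartic dvd [:?c:] * (F * G)"
      by (intro dvdI[of _ _ "[:ratio_slope ^ 4:]"]) (simp add: mult.commute)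
    moreover have "\<not> orbit_quartic dvd [:?c:]"
    proof
      assume "orbit_quartic dvd [:?c:]"
      moreover have "?c \<noteq> 0"
        by (simp only: mult_eq_0_iff power_eq_0_iff) simp
      ultimately show False
        using dvd_imp_degree_le[of orbit_quartic "[:?c:]"] degree_orbit_quartic(1)
        by (simp only: pCons_eq_0_iff degree_pCons_0) simp
    qed
    ultimately have "orbit_quartic dvd F \<or> orbit_quartic dvd G"
      using prime by (metis prime_elem_dvd_multD)
    moreover have "F \<noteq> 0" "G \<noteq> 0"
      using F G nz k0 by auto
    ultimately have "degree f \<ge> 4 \<or> degree g \<ge> 4"
      using dvd_imp_degree_le degree_orbit_quartic(1) F(2) G(2) by metis
    with deg have "degree f = 0 \<or> degree g = 0"
      by linarith
    thus "is_unit f \<or> is_unit g"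
    proof
      assume "degree f = 0"
      then obtain c where c: "f = [:c:]" by (rule degree_eq_zeroE)
      hence "[:c:] dvd return_quartic"
        unfolding fg by (simp only: dvd_triv_left dvd_triv_right)
      thus ?thesis
        unfolding c is_unit_const_poly_iff by (auto intro: return_quartic_constant_factor)
    next
      assume "degree g = 0"
      then obtain c where c: "g = [:c:]" by (rule degree_eq_zeroE)
      hence "[:c:] dvd return_quartic"
        unfolding fg by (simp only: dvd_triv_left dvd_triv_right)
      thus ?thesis
        unfolding c is_unit_const_poly_iff by (auto intro: return_quartic_constant_factor)
    qed
  qed
qed

section \<open>Adjoining the scale\<close>

text \<open>
  The outer variable is now the scale \<open>t\<close> itself.
\<close>

definition return_curve :: "complex poly poly" where
  "return_curve = pcompose return_quartic [:0, 0, 1:]"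

lemma eval2_pcompose_square: "eval2 (pcompose p [:0, 0, 1:]) (s, t) = eval2 p (s, t\<^sup>2)"
  by (induction p) (simp_all add: pcompose_pCons power2_eq_square)

lemma eval2_return_curve: "eval2 return_curve (s, t) = eval2 return_quartic (s, t\<^sup>2)"
  by (simp add: return_curve_def eval2_pcompose_square)

lemma degree_return_curve: "degree return_curve = 8"
  by (simp add: return_curve_def degree_pcompose return_quartic_expansion)

text \<open>
  The leading coefficient \<open>s\<^sup>5 (s - 1)\<^sup>3\<close> has a zero of odd order at 1.
\<close>

lemma lead_coeff_return_quartic_nonsquare:
  assumes "is_unit u"
  shows "u * lead_coeff return_quartic \<noteq> r\<^sup>2"
proof
  assume eq: "u * lead_coeff return_quartic = r\<^sup>2"
  have "u \<noteq> 0"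
    using assms by auto
  have "r \<noteq> 0"
    using eq \<open>u \<noteq> 0\<close> return_quartic_expansion by auto
  have "order 1 (r\<^sup>2) = 2 * order 1 r"
    using \<open>r \<noteq> 0\<close> by (simp add: power2_eq_square order_mult)
  moreover have "order 1 (u * ([:0, 1:] ^ 5 * [:-1, 1:] ^ 3)) = 3"
  proof -
    have "order 1 u = 0"
      using assms by (auto elim!: is_unit_polyE intro: order_0I)
    moreover have "order 1 ([:0, 1:] ^ 5 :: complex poly) = 0"
      by (intro order_0I) simp
    moreover have "order 1 ([:-1, 1:] ^ 3 :: complex poly) = 3"
      by (rule order_power_n_n)
    ultimately show ?thesis
      using \<open>u \<noteq> 0\<close> by (simp add: order_mult)
  qed
  ultimately have "2 * order 1 r = 3"
    using eq return_quartic_expansion(2) by simp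
  thus False by presburger
qed

lemma prime_elem_return_curve: "prime_elem return_curve"
proof -
  have "prime_elem return_quartic"
    by (intro irreducible_imp_prime_elem irreducible_return_quartic)
  moreover have "even (degree return_quartic)"
    by (simp add: return_quartic_expansion)
  ultimately have "irreducible return_curve"
    unfolding return_curve_def
    by (rule irreducible_pcompose_square) (rule lead_coeff_return_quartic_nonsquare)
  thus ?thesis
    by (rule irreducible_imp_prime_elem)
qed

section \<open>Orbits of the critical point\<close>

text \<open>
  An orbit \<open>a, a + t, a + t s, a + t w, \<dots>\<close> of the critical point \<open>a\<close> is recorded by the first ratio
  \<open>s\<close> and the scale \<open>t\<close>. The formulas come from \<open>P(a) = b - 2 a\<^sup>3\<close> and
  \<open>P(a + y) = P(a) + y\<^sup>3 + 3 a y\<^sup>2\<close>. For \<open>t \<noteq> 0\<close> the passage between \<open>(a, b)\<close> and \<open>(s, t)\<close> is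
  biregular.
\<close>

definition from_orbit_shape :: "complex \<times> complex \<Rightarrow> complex \<times> complex" where
  "from_orbit_shape = (\<lambda>(s, t). let a = (s - 1 - t\<^sup>2) / (3 * t) in (a, a + t + 2 * a ^ 3))"

definition orbit_shape :: "complex \<times> complex \<Rightarrow> complex \<times> complex" where
  "orbit_shape = (\<lambda>(a, b). let t = b - 2 * a ^ 3 - a in (1 + 3 * a * t + t\<^sup>2, t))"

lemma orbit_shape_from: "t \<noteq> 0 \<Longrightarrow> orbit_shape (from_orbit_shape (s, t)) = (s, t)"
  by (simp add: orbit_shape_def from_orbit_shape_def Let_def)

lemma from_orbit_shape:
  assumes "snd (orbit_shape x) \<noteq> 0"
  shows "from_orbit_shape (orbit_shape x) = x"
proof -
  obtain a b where x: "x = (a, b)" by (cases x)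
  define t where "t = b - 2 * a ^ 3 - a"
  have shape: "orbit_shape x = (1 + 3 * a * t + t\<^sup>2, t)"
    by (simp add: x orbit_shape_def t_def Let_def)
  with assms have "(1 + 3 * a * t + t\<^sup>2 - 1 - t\<^sup>2) / (3 * t) = a"
    by simp
  thus ?thesis
    unfolding shape by (simp add: from_orbit_shape_def Let_def x t_def)
qed

lemma cubic_shifted: "cubic a b (a + y) = a + (y ^ 3 + 3 * a * y\<^sup>2 + (b - 2 * a ^ 3 - a))"
  by (simp add: cubic_def power2_eq_square power3_eq_cube algebra_simps)

lemma cubic_step:
  assumes "orbit_shape (a, b) = (s, t)"
  shows "cubic a b (a + t * y) = a + t * (y\<^sup>2 * (t\<^sup>2 * (y - 1) + s - 1) + 1)"
proof -
  have t: "t = b - 2 * a ^ 3 - a" and s: "s = 1 + 3 * a * t + t\<^sup>2"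
    using assms by (auto simp: orbit_shape_def Let_def)
  show ?thesis
    unfolding cubic_shifted t[symmetric] s by (simp add: power2_eq_square power3_eq_cube algebra_simps)
qed

lemma cubic_orbit:
  assumes "orbit_shape (a, b) = (s, t)"
  defines "f \<equiv> cubic a b"
  shows "f a = a + t" and "f (f a) = a + t * s"
    and "f (f (f a)) = a + t * eval2 third_ratio (s, t\<^sup>2)"
    and "f (f (f (f a))) = a + t * (s * eval2 return_curve (s, t))"
proof -
  note step = cubic_step[OF assms(1), folded f_def]
  show 1: "f a = a + t"
    using step[of 0] by simp
  show 2: "f (f a) = a + t * s"
    using step[of 1] by (simp add: 1)
  show 3: "f (f (f a)) = a + t * eval2 third_ratio (s, t\<^sup>2)"
    using step[of s] by (simp add: 2 eval2_third_ratio power2_eq_square algebra_simps)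
  have "f (f (f (f a))) = a + t * ((eval2 third_ratio (s, t\<^sup>2))\<^sup>2
      * (t\<^sup>2 * (eval2 third_ratio (s, t\<^sup>2) - 1) + s - 1) + 1)"
    unfolding 3 by (rule step)
  also have "(eval2 third_ratio (s, t\<^sup>2))\<^sup>2
      * (t\<^sup>2 * (eval2 third_ratio (s, t\<^sup>2) - 1) + s - 1) + 1 = s * eval2 return_curve (s, t)"
    unfolding eval2_return_curve eval2_return_quartic eval2_third_ratio by algebra
  finally show "f (f (f (f a))) = a + t * (s * eval2 return_curve (s, t))" .
qed

lemma eval2_return_curve_eq_1: "s = 0 \<or> s = 1 \<Longrightarrow> eval2 return_curve (s, t) = 1"
  by (auto simp: eval2_return_curve eval2_return_quartic)

text \<open>
  The equation already excludes the smaller periods: it fails for \<open>s = 0\<close> (period 2) and, since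
  \<open>t = 0\<close> (period 1) forces \<open>s = 1\<close>, also for \<open>t = 0\<close>. Period 3 together with period 4 would be
  period 1.
\<close>

lemma mem_period_curve_4: "x \<in> period_curve 4 \<longleftrightarrow> eval2 return_curve (orbit_shape x) = 0"
proof -
  obtain a b where x: "x = (a, b)" by (cases x)
  obtain s t where st: "orbit_shape (a, b) = (s, t)" by (cases "orbit_shape (a, b)")
  define f where "f = cubic a b"
  note orbit = cubic_orbit[OF st, folded f_def]
  have "(\<forall>k. 0 < k \<and> k < 4 \<longrightarrow> (f ^^ k) a \<noteq> a) \<longleftrightarrow> f a \<noteq> a \<and> f (f a) \<noteq> a \<and> f (f (f a)) \<noteq> a"
  proof -
    have "0 < k \<and> k < 4 \<longleftrightarrow> k = 1 \<or> k = 2 \<or> k = (3::nat)" for k by auto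
    thus ?thesis by (auto simp: numeral_2_eq_2 numeral_3_eq_3)
  qed
  hence "x \<in> period_curve 4 \<longleftrightarrow>
      f (f (f (f a))) = a \<and> f a \<noteq> a \<and> f (f a) \<noteq> a \<and> f (f (f a)) \<noteq> a"
    by (simp add: x period_curve_def exact_period_def f_def[symmetric] eval_nat_numeral)
  also have "\<dots> \<longleftrightarrow> f (f (f (f a))) = a \<and> f a \<noteq> a \<and> f (f a) \<noteq> a"
    by metis
  also have "\<dots> \<longleftrightarrow> eval2 return_curve (s, t) = 0"
  proof -
    have "t \<noteq> 0" "s \<noteq> 0" if "eval2 return_curve (s, t) = 0"
    proof -
      have "s = 1" if "t = 0"
        using st that by (auto simp: orbit_shape_def Let_def)
      thus "t \<noteq> 0" "s \<noteq> 0"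
        using eval2_return_curve_eq_1[of s t] that by auto
    qed
    moreover have "f (f (f (f a))) = a \<longleftrightarrow> t = 0 \<or> s = 0 \<or> eval2 return_curve (s, t) = 0"
      by (subst orbit(4)) simp
    moreover have "f (f a) = a \<longleftrightarrow> t = 0 \<or> s = 0"
      by (subst orbit(2)) simp
    moreover have "f a = a \<longleftrightarrow> t = 0"
      by (subst orbit(1)) simp
    ultimately show ?thesis
      by blast
  qed
  finally show ?thesis
    by (simp add: x st)
qed

section \<open>Regular functions on the complement of a curve\<close>

text \<open>
  The restriction to the set where \<open>d\<close> does not vanish lies in \<open>\<complex>[x, y, 1/d]\<close>; stated for functions, so that
  closure properties need no quotient ring. For
  \<open>d = 1\<close> these are the polynomial functions.
\<close>

definition regular_off :: "complex poly poly \<Rightarrow> (complex \<times> complex \<Rightarrow> complex) \<Rightarrow> bool" where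
  "regular_off d \<phi> \<longleftrightarrow> (\<exists>N F. \<forall>x. eval2 d x \<noteq> 0 \<longrightarrow> eval2 F x = eval2 d x ^ N * \<phi> x)"

lemma regular_offI: "(\<And>x. eval2 d x \<noteq> 0 \<Longrightarrow> eval2 F x = eval2 d x ^ N * \<phi> x) \<Longrightarrow> regular_off d \<phi>"
  unfolding regular_off_def by blast

lemma regular_off_const: "regular_off d (\<lambda>x. c)"
  by (rule regular_offI[of _ "[:[:c:]:]" 0]) (auto simp: eval2_def)

lemma regular_off_fst: "regular_off d fst"
  by (rule regular_offI[of _ "[:[:0, 1:]:]" 0]) (auto simp: eval2_def)

lemma regular_off_snd: "regular_off d snd"
  by (rule regular_offI[of _ "[:0, 1:]" 0]) (auto simp: eval2_def)

lemma regular_off_inverse: "regular_off d (\<lambda>x. inverse (eval2 d x))"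
  by (rule regular_offI[of _ 1 1]) simp

lemma regular_off_add:
  assumes "regular_off d \<phi>" "regular_off d \<psi>"
  shows "regular_off d (\<lambda>x. \<phi> x + \<psi> x)"
proof -
  obtain N F M G where "\<And>x. eval2 d x \<noteq> 0 \<Longrightarrow> eval2 F x = eval2 d x ^ N * \<phi> x"
    and "\<And>x. eval2 d x \<noteq> 0 \<Longrightarrow> eval2 G x = eval2 d x ^ M * \<psi> x"
    using assms unfolding regular_off_def by metis
  thus ?thesis
    by (intro regular_offI[of _ "d ^ M * F + d ^ N * G" "N + M"]) (simp add: power_add algebra_simps)
qed

lemma regular_off_mult:
  assumes "regular_off d \<phi>" "regular_off d \<psi>"
  shows "regular_off d (\<lambda>x. \<phi> x * \<psi> x)"
proof -
  obtain N F M G where "\<And>x. eval2 d x \<noteq> 0 \<Longrightarrow> eval2 F x = eval2 d x ^ N * \<phi> x"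
    and "\<And>x. eval2 d x \<noteq> 0 \<Longrightarrow> eval2 G x = eval2 d x ^ M * \<psi> x"
    using assms unfolding regular_off_def by metis
  thus ?thesis
    by (intro regular_offI[of _ "F * G" "N + M"]) (simp add: power_add algebra_simps)
qed

lemma regular_off_diff:
  assumes "regular_off d \<phi>" "regular_off d \<psi>"
  shows "regular_off d (\<lambda>x. \<phi> x - \<psi> x)"
  using regular_off_add[OF assms(1) regular_off_mult[OF regular_off_const[of d "-1"] assms(2)]] by simp

lemma regular_off_power: "regular_off d \<phi> \<Longrightarrow> regular_off d (\<lambda>x. \<phi> x ^ n)"
  by (induction n) (simp_all add: regular_off_const regular_off_mult)

lemmas regular_off_intros = regular_off_const regular_off_fst regular_off_snd
  regular_off_add regular_off_mult regular_off_diff regular_off_power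

lemma regular_off_compose:
  assumes \<phi>: "regular_off d (\<lambda>x. fst (m x))" and \<psi>: "regular_off d (\<lambda>x. snd (m x))"
  shows "regular_off d (\<lambda>x. eval2 p (m x))"
proof -
  have inner: "regular_off d (\<lambda>x. poly c (fst (m x)))" for c
    by (induction c) (simp_all add: regular_off_const regular_off_add regular_off_mult \<phi>)
  have eval2_pair: "eval2 (pCons c q) y = poly c (fst y) + snd y * eval2 q y" for c q y
    by (cases y) simp
  show ?thesis
    by (induction p)
      (simp_all add: eval2_pair regular_off_const regular_off_add regular_off_mult \<psi> inner)
qed

section \<open>Irreducibility of the curve\<close>

lemma period_curve_4_equation:
  "\<exists>p. \<forall>x. eval2 p x = eval2 return_curve (orbit_shape x)"
proof -
  have "regular_off 1 (\<lambda>x. eval2 return_curve (orbit_shape x))"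
    by (intro regular_off_compose)
      (auto simp: orbit_shape_def Let_def case_prod_beta intro!: regular_off_intros)
  thus ?thesis
    unfolding regular_off_def by simp
qed

lemma pullback_to_orbit_shapes:
  "\<exists>F N. \<forall>s t. t \<noteq> 0 \<longrightarrow> eval2 F (s, t) = t ^ N * eval2 f (from_orbit_shape (s, t))"
proof -
  have d: "eval2 [:0, 1:] x = snd x" for x
    by (cases x) simp
  have a: "regular_off [:0, 1:] (\<lambda>x. (fst x - 1 - (snd x)\<^sup>2) * (inverse (snd x) * (1 / 3)))"
    using regular_off_inverse[of "[:0, 1:]"] unfolding d by (intro regular_off_intros)
  have "regular_off [:0, 1:] (\<lambda>x. eval2 f (from_orbit_shape x))"
  proof (rule regular_off_compose)
    show fst: "regular_off [:0, 1:] (\<lambda>x. fst (from_orbit_shape x))"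
      using a by (simp add: from_orbit_shape_def Let_def case_prod_beta field_simps)
    have "regular_off [:0, 1:]
        (\<lambda>x. fst (from_orbit_shape x) + snd x + 2 * fst (from_orbit_shape x) ^ 3)"
      by (intro regular_off_intros fst)
    thus "regular_off [:0, 1:] (\<lambda>x. snd (from_orbit_shape x))"
      by (simp add: from_orbit_shape_def Let_def case_prod_beta)
  qed
  then obtain F N where "\<forall>x. snd x \<noteq> 0 \<longrightarrow> eval2 F x = snd x ^ N * eval2 f (from_orbit_shape x)"
    unfolding regular_off_def d by blast
  thus ?thesis
    by (intro exI[of _ F] exI[of _ N]) simp
qed

lemma period_curve_4_shape:
  assumes "x \<in> period_curve 4"
  shows "snd (orbit_shape x) \<noteq> 0"
proof
  assume "snd (orbit_shape x) = 0"
  hence "orbit_shape x = (1, 0)"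
    by (cases x) (auto simp: orbit_shape_def Let_def)
  with assms eval2_return_curve_eq_1[of 1 0] show False
    by (simp add: mem_period_curve_4)
qed

lemma from_orbit_shape_mem:
  assumes "eval2 return_curve (s, t) = 0" "t \<noteq> 0"
  shows "from_orbit_shape (s, t) \<in> period_curve 4"
  using assms by (simp add: mem_period_curve_4 orbit_shape_from)

lemma return_curve_not_dvd_t: "\<not> return_curve dvd [:0, 1:]"
  using dvd_imp_degree_le[of return_curve "[:0, 1:]"] degree_return_curve by auto

lemma period_curve_4_nonempty: "period_curve 4 \<noteq> {}"
proof
  assume empty: "period_curve 4 = {}"
  have "return_curve dvd [:0, 1:]"
  proof (rule nullstellensatz_prime[OF prime_elem_return_curve])
    show "0 < degree return_curve"
      by (simp add: degree_return_curve)
    show "eval2 [:0, 1:] (s, t) = 0" if "eval2 return_curve (s, t) = 0" for s t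
      using from_orbit_shape_mem[OF that] empty by auto
  qed
  with return_curve_not_dvd_t show False ..
qed

text \<open>
  Polynomials in \<open>a\<close> and \<open>b\<close> become polynomials in \<open>s\<close> and \<open>t\<close> after multiplication with a power of
  \<open>t\<close>, and the additional factor \<open>t\<close> takes care of zeros of the return polynomial with \<open>t = 0\<close>. So the
  claim reduces to the primality of the return polynomial and the Nullstellensatz for it.
\<close>

lemma period_curve_4_no_zero_divisors:
  assumes "\<And>x. x \<in> period_curve 4 \<Longrightarrow> eval2 f x * eval2 g x = 0"
  shows "(\<forall>x\<in>period_curve 4. eval2 f x = 0) \<or> (\<forall>x\<in>period_curve 4. eval2 g x = 0)"
proof -
  obtain F N where F: "\<forall>s t. t \<noteq> 0 \<longrightarrow> eval2 F (s, t) = t ^ N * eval2 f (from_orbit_shape (s, t))"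
    using pullback_to_orbit_shapes[of f] by blast
  obtain G M where G: "\<forall>s t. t \<noteq> 0 \<longrightarrow> eval2 G (s, t) = t ^ M * eval2 g (from_orbit_shape (s, t))"
    using pullback_to_orbit_shapes[of g] by blast
  have "return_curve dvd [:0, 1:] * (F * G)"
  proof (rule nullstellensatz_prime[OF prime_elem_return_curve])
    show "0 < degree return_curve"
      by (simp add: degree_return_curve)
    show "eval2 ([:0, 1:] * (F * G)) (s, t) = 0" if "eval2 return_curve (s, t) = 0" for s t
      using assms[OF from_orbit_shape_mem[OF that]] by (cases "t = 0") (auto simp: F G)
  qed
  hence "return_curve dvd F * G"
    using prime_elem_dvd_multD[OF prime_elem_return_curve] return_curve_not_dvd_t by blast
  hence "return_curve dvd F \<or> return_curve dvd G"
    by (rule prime_elem_dvd_multD[OF prime_elem_return_curve])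
  moreover have vanish: "\<forall>x\<in>period_curve 4. eval2 h x = 0"
    if dvd: "return_curve dvd H"
      and H: "\<forall>s t. t \<noteq> 0 \<longrightarrow> eval2 H (s, t) = t ^ K * eval2 h (from_orbit_shape (s, t))"
    for h H K
  proof
    fix x assume x: "x \<in> period_curve 4"
    obtain s t where st: "orbit_shape x = (s, t)" by (cases "orbit_shape x")
    from dvd obtain q where q: "H = return_curve * q" ..
    have "eval2 H (s, t) = 0"
      using x by (simp add: q mem_period_curve_4 st)
    moreover have "t \<noteq> 0" "from_orbit_shape (s, t) = x"
      using period_curve_4_shape[OF x] from_orbit_shape[of x] by (simp_all add: st)
    ultimately show "eval2 h x = 0"
      using H by simp
  qed
  ultimately show ?thesis
    using vanish[OF _ F] vanish[OF _ G] by blast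
qed

lemma affine_plane_curve_period_curve_4: "affine_plane_curve (period_curve 4)"
proof -
  obtain p where p: "\<forall>x. eval2 p x = eval2 return_curve (orbit_shape x)"
    using period_curve_4_equation by blast
  have "p \<noteq> [:[:c:]:]" for c
  proof
    assume "p = [:[:c:]:]"
    hence const: "eval2 p x = c" for x
      by (cases x) simp
    have "eval2 p (0, 0) = 1"
      using eval2_return_curve_eq_1[of 1 0] by (simp add: p orbit_shape_def)
    moreover obtain x where "x \<in> period_curve 4"
      using period_curve_4_nonempty by blast
    hence "eval2 p x = 0"
      by (simp add: p mem_period_curve_4)
    ultimately show False
      by (simp add: const)
  qed
  moreover have "period_curve 4 = zero_locus {p}"
    by (auto simp: zero_locus_def p mem_period_curve_4)
  ultimately show ?thesis
    unfolding affine_plane_curve_def by blast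
qed

text \<open>
  If neither \<open>Y\<close> nor \<open>Z\<close> were the whole curve, an equation of \<open>Y\<close> and an equation of \<open>Z\<close>, neither of
  which holds on the whole curve, would have a product that vanishes on it.
\<close>

lemma irreducible_period_curve_4: "irreducible_algebraic_set (period_curve 4)"
  unfolding irreducible_algebraic_set_def
proof (intro conjI allI impI)
  show "algebraic_set (period_curve 4)"
    using affine_plane_curve_period_curve_4
    unfolding affine_plane_curve_def algebraic_set_def by blast
  show "period_curve 4 \<noteq> {}"
    by (rule period_curve_4_nonempty)
  fix Y Z
  assume "algebraic_set Y \<and> algebraic_set Z \<and> period_curve 4 = Y \<union> Z"
  then obtain F G where Y: "Y = zero_locus F" and Z: "Z = zero_locus G"
    and union: "period_curve 4 = Y \<union> Z"
    unfolding algebraic_set_def by blast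
  show "period_curve 4 = Y \<or> period_curve 4 = Z"
  proof (rule ccontr)
    assume "\<not> ?thesis"
    with union obtain y z where y: "y \<in> period_curve 4" "y \<notin> Y" and z: "z \<in> period_curve 4" "z \<notin> Z"
      by blast
    from y z obtain f g where f: "f \<in> F" "eval2 f y \<noteq> 0" and g: "g \<in> G" "eval2 g z \<noteq> 0"
      unfolding Y Z zero_locus_def by blast
    have "eval2 f x * eval2 g x = 0" if "x \<in> period_curve 4" for x
      using that f g unfolding union Y Z zero_locus_def by auto
    with y z f g show False
      using period_curve_4_no_zero_divisors[of f g] by blast
  qed
qed

theorem theorem1:
  "affine_plane_curve (period_curve 4) \<and> irreducible_algebraic_set (period_curve 4)"
  using affine_plane_curve_period_curve_4 irreducible_period_curve_4 ..

end
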